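(* Let $m\ge1$ be an integer and let $C=a\,C_a\oplus b\,C_b$ be an $H_{23}$-code of length $n=2m$, with binary component $C_a\subseteq\mathbb{F}_2^{n}$ and ternary component $C_b\subseteq\mathbb{F}_3^{n}$. Then $C$ is symplectic LCD (i.e. $C\cap C^{\perp_S}=\{\mathbf{0}\}$) if and only if $C_a$ is binary symplectic LCD and $C_b=\{\mathbf{0}\}$.
   Context: Ring: $H_{23}=\langle a,b\mid 2a=0,\ 3b=0,\ a^2=a,\ b^2=0,\ ab=ba=0\rangle$ is the commutative non-unital ring of order six with elements $0,a,b,a+b,2b,a+2b$. For $\mathbf{x}\in\mathbb{F}_2^n$, $a\mathbf{x}$ is the vector obtained coordinatewise from $a\cdot0=0$, $a\cdot1=a$; for $\mathbf{y}\in\mathbb{F}_3^n$, $b\mathbf{y}$ is obtained coordinatewise from $b\cdot0=0$, $b\cdot1=b$, $b\cdot2=2b$. Every vector of $H_{23}^n$ is uniquely $a\mathbf{x}+b\mathbf{y}$ with $\mathbf{x}\in\mathbb{F}_2^n$, $\mathbf{y}\in\mathbb{F}_3^n$. Codes: an $H_{23}$-code of length $n$ is an $H_{23}$-submodule $C\subseteq H_{23}^n$ (an additive subgroup closed under multiplication by elements of $H_{23}$). It decomposes as $C=aC_a\oplus bC_b=\{a\mathbf{u}+b\mathbf{v}: \mathbf{u}\in C_a,\mathbf{v}\in C_b\}$ with $C_a=\{\mathbf{u}\in\mathbb{F}_2^n: a\mathbf{u}\in C\}$ and $C_b=\{\mathbf{v}\in\mathbb{F}_3^n: b\mathbf{v}\in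 C\}$, which are linear codes over $\mathbb{F}_2$ and $\mathbb{F}_3$ respectively. Symplectic forms: for $\mathbf{x}=(\mathbf{x}_1\mid\mathbf{x}_2),\mathbf{y}=(\mathbf{y}_1\mid\mathbf{y}_2)\in\mathbb{F}_2^{2m}$ with $\mathbf{x}_i,\mathbf{y}_i\in\mathbb{F}_2^m$, set $\langle\mathbf{x},\mathbf{y}\rangle_s^{(\mathbb{F}_2)}=\mathbf{x}_1\cdot\mathbf{y}_2+\mathbf{x}_2\cdot\mathbf{y}_1$, where $\cdot$ is the usual dot product. For $\mathbf{c}=a\mathbf{x}+b\mathbf{y}$, $\mathbf{c}'=a\mathbf{x}'+b\mathbf{y}'$ in $H_{23}^{2m}$ (with $\mathbf{x},\mathbf{x}'\in\mathbb{F}_2^{2m}$, $\mathbf{y},\mathbf{y}'\in\mathbb{F}_3^{2m}$), set $\langle\mathbf{c},\mathbf{c}'\rangle_S=a\langle\mathbf{x},\mathbf{x}'\rangle_s^{(\mathbb{F}_2)}$ (the ternary part contributes $0$ because $b^2=0$). The symplectic dual $C^{\perp_S}$ of a code $C$ (over $\mathbb{F}_2$ or $H_{23}$, of length $2m$) is the set of all vectors of the ambient space orthogonal to every element of $C$ under the corresponding symplectic form. $C$ is symplectic LCD (linear complementary dual) if $C\cap C^{\perp_S}=\{\mathbf{0}\}$. *)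

theory Defs
  imports "Jordan_Normal_Form.Matrix" "HOL-Library.Z2" "HOL-Library.Numeral_Type"
begin

type_synonym F2 = bit
type_synonym F3 = 3

text \<open>Every element is \<open>a x + b y\<close> for a unique pair \<open>(x, y)\<close> in \<open>F2 \<times> F3\<close>, and it is represented
  by that pair. The presentation is recovered in \<open>H23_presentation\<close> and \<open>H23_elements\<close> below.\<close>

datatype H23 = H23 (bin_part: F2) (tern_part: F3)

instantiation H23 :: comm_ring
begin

definition "0 = H23 0 0"
definition "g + h = H23 (bin_part g + bin_part h) (tern_part g + tern_part h)"
definition "- g = H23 (- bin_part g) (- tern_part g)"
definition "g - h = H23 (bin_part g - bin_part h) (tern_part g - tern_part h)"
definition "g * h = H23 (bin_part g * bin_part h) 0"

instance
  by standard
    (simp_all only: zero_H23_def plus_H23_def uminus_H23_def minus_H23_def times_H23_def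
      H23.sel H23.collapse H23.inject ac_simps distrib_left distrib_right add_0_left add_0_right
      left_minus right_minus diff_conv_add_uminus mult_zero_left mult_zero_right)

end

definition gen_a :: H23 where "gen_a = H23 1 0"
definition gen_b :: H23 where "gen_b = H23 0 1"

lemma F3_cases: "y = 0 \<or> y = 1 \<or> y = 2" for y :: F3
proof (cases y)
  case (of_int z)
  then have "z = 0 \<or> z = 1 \<or> z = 2" by auto
  with of_int show ?thesis by auto
qed

lemma H23_presentation:
  "gen_a + gen_a = 0" "gen_b + gen_b + gen_b = 0"
  "gen_a * gen_a = gen_a" "gen_b * gen_b = 0" "gen_a * gen_b = 0" "gen_b * gen_a = 0"
  by (simp_all add: gen_a_def gen_b_def zero_H23_def plus_H23_def times_H23_def)

lemma H23_elements:
  "(UNIV :: H23 set) =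
     {0, gen_a, gen_b, gen_a + gen_b, gen_b + gen_b, gen_a + (gen_b + gen_b)}"
proof -
  have "h \<in> {0, gen_a, gen_b, gen_a + gen_b, gen_b + gen_b, gen_a + (gen_b + gen_b)}" for h
  proof (cases h)
    case (H23 x y)
    then show ?thesis
      using F3_cases[of y] by (cases x) (auto simp: gen_a_def gen_b_def zero_H23_def plus_H23_def)
  qed
  then show ?thesis by blast
qed

lemma card_H23: "card (UNIV :: H23 set) = 6"
  unfolding H23_elements by (simp add: gen_a_def gen_b_def zero_H23_def plus_H23_def)

definition a_times :: "F2 \<Rightarrow> H23" where
  "a_times x = (if x = 0 then 0 else gen_a)"

definition b_times :: "F3 \<Rightarrow> H23" where
  "b_times y = (if y = 0 then 0 else if y = 1 then gen_b else gen_b + gen_b)"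

lemma a_times_eq: "a_times x = H23 x 0"
  by (cases x) (simp_all add: a_times_def gen_a_def zero_H23_def)

lemma b_times_eq: "b_times y = H23 0 y"
  using F3_cases[of y] by (auto simp: b_times_def gen_b_def zero_H23_def plus_H23_def)

definition a_vec :: "F2 vec \<Rightarrow> H23 vec" where "a_vec = map_vec a_times"
definition b_vec :: "F3 vec \<Rightarrow> H23 vec" where "b_vec = map_vec b_times"

lemma vec_bin_tern_parts:
  "c = a_vec x + b_vec y \<longleftrightarrow> x = map_vec bin_part c \<and> y = map_vec tern_part c"
  if "c \<in> carrier_vec n" "x \<in> carrier_vec n" "y \<in> carrier_vec n"
proof
  assume c: "c = a_vec x + b_vec y"
  have "c $ i = H23 (x $ i) (y $ i)" if "i < n" for i
    using that \<open>x \<in> carrier_vec n\<close> \<open>y \<in> carrier_vec n\<close>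
    by (simp only: c a_vec_def b_vec_def a_times_eq b_times_eq plus_H23_def index_add_vec
        index_map_vec carrier_vecD H23.sel add_0_left add_0_right)
  then show "x = map_vec bin_part c \<and> y = map_vec tern_part c"
    using \<open>c \<in> carrier_vec n\<close> \<open>x \<in> carrier_vec n\<close> \<open>y \<in> carrier_vec n\<close> by auto
next
  assume "x = map_vec bin_part c \<and> y = map_vec tern_part c"
  then show "c = a_vec x + b_vec y"
    by (intro eq_vecI)
      (simp_all add: a_vec_def b_vec_def a_times_eq b_times_eq plus_H23_def H23.expand)
qed

text \<open>\<open>H\<^sub>2\<^sub>3\<close> has no unit, so the module notions of the library do not apply. As \<open>H\<^sub>2\<^sub>3\<close> is
  commutative, left and right multiplication need not be distinguished.\<close>

definition H23_code :: "nat \<Rightarrow> H23 vec set \<Rightarrow> bool" where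
  "H23_code n C \<longleftrightarrow>
     C \<subseteq> carrier_vec n \<and> 0\<^sub>v n \<in> C \<and>
     (\<forall>c\<in>C. \<forall>d\<in>C. c + d \<in> C) \<and> (\<forall>c\<in>C. - c \<in> C) \<and>
     (\<forall>h. \<forall>c\<in>C. h \<cdot>\<^sub>v c \<in> C)"

definition bin_component :: "nat \<Rightarrow> H23 vec set \<Rightarrow> F2 vec set" where
  "bin_component n C = {u \<in> carrier_vec n. a_vec u \<in> C}"

definition tern_component :: "nat \<Rightarrow> H23 vec set \<Rightarrow> F3 vec set" where
  "tern_component n C = {v \<in> carrier_vec n. b_vec v \<in> C}"

lemma H23_code_decomposition:
  assumes "H23_code n C"
  shows "C = {a_vec u + b_vec v | u v. u \<in> bin_component n C \<and> v \<in> tern_component n C}"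
proof (intro equalityI subsetI)
  fix c assume c: "c \<in> C"
  then have n: "c \<in> carrier_vec n" using assms by (auto simp: H23_code_def)
  let ?u = "map_vec bin_part c" and ?v = "map_vec tern_part c"
  have "gen_a \<cdot>\<^sub>v c = a_vec ?u"
    by (auto simp: a_vec_def a_times_eq gen_a_def times_H23_def)
  with c assms have u: "a_vec ?u \<in> C" unfolding H23_code_def by metis
  have eq: "c = a_vec ?u + b_vec ?v" using vec_bin_tern_parts[of c n ?u ?v] n by auto
  have "b_vec ?v = c + - a_vec ?u"
    by (auto simp: a_vec_def b_vec_def a_times_eq b_times_eq plus_H23_def uminus_H23_def)
  with u c assms have v: "b_vec ?v \<in> C" unfolding H23_code_def by metis
  show "c \<in> {a_vec u + b_vec v | u v. u \<in> bin_component n C \<and> v \<in> tern_component n C}"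
  proof (intro CollectI exI conjI)
    show "c = a_vec ?u + b_vec ?v" by (fact eq)
  qed (use u v n in \<open>simp_all add: bin_component_def tern_component_def\<close>)
next
  fix c
  assume "c \<in> {a_vec u + b_vec v | u v. u \<in> bin_component n C \<and> v \<in> tern_component n C}"
  then show "c \<in> C"
    using assms unfolding H23_code_def bin_component_def tern_component_def by blast
qed

text \<open>A vector of length \<open>2 * m\<close> is split as \<open>x = vec_first x m @\<^sub>v vec_last x m\<close>.\<close>

definition symp_form_F2 :: "nat \<Rightarrow> F2 vec \<Rightarrow> F2 vec \<Rightarrow> F2" where
  "symp_form_F2 m x y =
     vec_first x m \<bullet> vec_last y m + vec_last x m \<bullet> vec_first y m"

definition symp_form_H23 :: "nat \<Rightarrow> H23 vec \<Rightarrow> H23 vec \<Rightarrow> H23" where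
  "symp_form_H23 m c d = a_times (symp_form_F2 m (map_vec bin_part c) (map_vec bin_part d))"

lemma symp_form_H23_eq:
  assumes "x \<in> carrier_vec (2 * m)" "x' \<in> carrier_vec (2 * m)"
    and "y \<in> carrier_vec (2 * m)" "y' \<in> carrier_vec (2 * m)"
  shows "symp_form_H23 m (a_vec x + b_vec y) (a_vec x' + b_vec y') = a_times (symp_form_F2 m x x')"
proof -
  have carr: "a_vec x + b_vec y \<in> carrier_vec (2 * m)" "a_vec x' + b_vec y' \<in> carrier_vec (2 * m)"
    using assms by (auto simp: a_vec_def b_vec_def)
  have "map_vec bin_part (a_vec x + b_vec y) = x" "map_vec bin_part (a_vec x' + b_vec y') = x'"
    using vec_bin_tern_parts[OF carr(1) assms(1,3)] vec_bin_tern_parts[OF carr(2) assms(2,4)]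
    by simp_all
  then show ?thesis by (simp add: symp_form_H23_def)
qed

definition dual_code ::
    "('a vec \<Rightarrow> 'a vec \<Rightarrow> 'a::zero) \<Rightarrow> nat \<Rightarrow> 'a vec set \<Rightarrow> 'a vec set" where
  "dual_code form n C = {x \<in> carrier_vec n. \<forall>c\<in>C. form x c = 0}"

definition lcd_code :: "('a vec \<Rightarrow> 'a vec \<Rightarrow> 'a::zero) \<Rightarrow> nat \<Rightarrow> 'a vec set \<Rightarrow> bool" where
  "lcd_code form n C \<longleftrightarrow> C \<inter> dual_code form n C = {0\<^sub>v n}"

definition symp_LCD_F2 :: "nat \<Rightarrow> F2 vec set \<Rightarrow> bool" where
  "symp_LCD_F2 m C \<longleftrightarrow> lcd_code (symp_form_F2 m) (2 * m) C"

definition symp_LCD_H23 :: "nat \<Rightarrow> H23 vec set \<Rightarrow> bool" where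
  "symp_LCD_H23 m C \<longleftrightarrow> lcd_code (symp_form_H23 m) (2 * m) C"

end

(* The radical of C under the symplectic form is a (C_a \<inter> C_a\<^sup>\<bottom>) \<oplus> b C_b: the form only sees the binary part,
   so every ternary codeword is orthogonal to everything. It vanishes iff both summands do. *)
theory Submission
  imports Defs
begin

text \<open>Multiplication by a is injective on bits, so orthogonality under the ring-valued form is
  the same as orthogonality of the binary parts.\<close>

lemma a_times_eq_0_iff [simp]: "a_times x = 0 \<longleftrightarrow> x = 0"
  by (simp add: a_times_eq zero_H23_def)

text \<open>Uniqueness of the decomposition, applied to the zero vector, whose binary and ternary
  parts are both zero.\<close>

lemma a_vec_plus_b_vec_eq_0_iff:
  assumes "u \<in> carrier_vec n" "v \<in> carrier_vec n"
  shows "a_vec u + b_vec v = 0\<^sub>v n \<longleftrightarrow> u = 0\<^sub>v n \<and> v = 0\<^sub>v n"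
proof -
  have "map_vec bin_part (0\<^sub>v n) = 0\<^sub>v n" "map_vec tern_part (0\<^sub>v n) = 0\<^sub>v n"
    by (auto simp: zero_H23_def)
  then show ?thesis
    using vec_bin_tern_parts[OF zero_carrier_vec assms] by metis
qed

lemma map_bin_part_a_vec_plus_b_vec:
  assumes "u \<in> carrier_vec n" "v \<in> carrier_vec n"
  shows "map_vec bin_part (a_vec u + b_vec v) = u"
  using vec_bin_tern_parts[OF _ assms, of "a_vec u + b_vec v"] assms
  by (simp add: a_vec_def b_vec_def)

lemma zero_in_components:
  assumes "H23_code n C"
  shows "0\<^sub>v n \<in> bin_component n C" "0\<^sub>v n \<in> tern_component n C"
proof -
  have "a_vec (0\<^sub>v n) = 0\<^sub>v n" "b_vec (0\<^sub>v n) = 0\<^sub>v n"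
    by (auto simp: a_vec_def b_vec_def a_times_def b_times_def)
  then show "0\<^sub>v n \<in> bin_component n C" "0\<^sub>v n \<in> tern_component n C"
    using assms by (simp_all add: bin_component_def tern_component_def H23_code_def)
qed

text \<open>A codeword a u + b v has binary part u, and conversely each u in the binary component is
  the binary part of the codeword a u. This turns a quantifier over \<open>C\<close> into one over
  its binary component.\<close>

lemma map_bin_part_image:
  assumes "H23_code n C"
  shows "map_vec bin_part ` C = bin_component n C"
proof
  show "map_vec bin_part ` C \<subseteq> bin_component n C"
  proof safe
    fix c assume "c \<in> C"
    then obtain u v where "c = a_vec u + b_vec v" "u \<in> bin_component n C" "v \<in> tern_component n C"
      using H23_code_decomposition[OF assms] by blast
    then show "map_vec bin_part c \<in> bin_component n C"
      by (simp add: bin_component_def tern_component_def map_bin_part_a_vec_plus_b_vec[of _ n])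
  qed
  show "bin_component n C \<subseteq> map_vec bin_part ` C"
  proof
    fix u assume "u \<in> bin_component n C"
    moreover from this have "map_vec bin_part (a_vec u) = u"
      by (auto simp: a_vec_def a_times_eq)
    ultimately show "u \<in> map_vec bin_part ` C"
      by (metis (mono_tags, lifting) bin_component_def imageI mem_Collect_eq)
  qed
qed

lemma symp_form_F2_zero_left: "symp_form_F2 m (0\<^sub>v (2 * m)) y = 0"
  by (simp add: symp_form_F2_def scalar_prod_def vec_first_def vec_last_def)

text \<open>The form reads both arguments through \<open>bin_part\<close> only, so testing against
  all of \<open>C\<close> is testing against the image of \<open>C\<close> under it.\<close>

lemma dual_code_symp_form_H23:
  assumes "H23_code (2 * m) C"
  shows "dual_code (symp_form_H23 m) (2 * m) C =
    {c \<in> carrier_vec (2 * m).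
       map_vec bin_part c \<in> dual_code (symp_form_F2 m) (2 * m) (bin_component (2 * m) C)}"
  by (auto simp: dual_code_def symp_form_H23_def map_bin_part_image[OF assms, symmetric])

text \<open>For a codeword a u + b v, membership in the dual is a condition on u alone, so
  intersecting with the dual shrinks the range of u and leaves that of v intact.\<close>

lemma radical_decomposition:
  assumes "H23_code (2 * m) C"
  defines "D \<equiv> bin_component (2 * m) C"
  shows "C \<inter> dual_code (symp_form_H23 m) (2 * m) C =
    {a_vec u + b_vec v | u v.
       u \<in> D \<inter> dual_code (symp_form_F2 m) (2 * m) D \<and> v \<in> tern_component (2 * m) C}"
proof -
  have dual: "a_vec u + b_vec v \<in> dual_code (symp_form_H23 m) (2 * m) C \<longleftrightarrow>
      u \<in> dual_code (symp_form_F2 m) (2 * m) D"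
    if "u \<in> D" "v \<in> tern_component (2 * m) C" for u v
  proof -
    have uv: "u \<in> carrier_vec (2 * m)" "v \<in> carrier_vec (2 * m)"
      using that by (simp_all add: D_def bin_component_def tern_component_def)
    then have "a_vec u + b_vec v \<in> carrier_vec (2 * m)"
      by (simp add: a_vec_def b_vec_def)
    then show ?thesis
      using uv by (simp add: dual_code_symp_form_H23[OF assms(1)] D_def
          map_bin_part_a_vec_plus_b_vec[of _ "2 * m"])
  qed
  have code: "C = {a_vec u + b_vec v | u v. u \<in> D \<and> v \<in> tern_component (2 * m) C}"
    unfolding D_def by (fact H23_code_decomposition[OF assms(1)])
  show ?thesis (is "?L = ?R")
  proof (intro equalityI subsetI)
    fix c assume "c \<in> ?L"
    moreover from this obtain u v
      where "c = a_vec u + b_vec v" "u \<in> D" "v \<in> tern_component (2 * m) C"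
      using code by blast
    ultimately show "c \<in> ?R" using dual by blast
  next
    fix c assume "c \<in> ?R"
    then obtain u v where c: "c = a_vec u + b_vec v"
      and uv: "u \<in> D" "u \<in> dual_code (symp_form_F2 m) (2 * m) D" "v \<in> tern_component (2 * m) C"
      by blast
    \<comment> \<open>The rewriting is done once only: \<open>C\<close> recurs on the right-hand
      side of \<open>code\<close>, inside \<open>tern_component\<close>.\<close>
    then have "c \<in> C" by (subst code) blast
    then show "c \<in> ?L" using c uv dual by blast
  qed
qed

theorem theorem4p13:
  fixes m :: nat and C :: "H23 vec set"
  assumes "m \<ge> 1" and "H23_code (2 * m) C"
  shows "symp_LCD_H23 m C \<longleftrightarrow>
    symp_LCD_F2 m (bin_component (2 * m) C) \<and> tern_component (2 * m) C = {0\<^sub>v (2 * m)}"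
proof -
  define R where "R = bin_component (2 * m) C \<inter>
    dual_code (symp_form_F2 m) (2 * m) (bin_component (2 * m) C)"
  define T where "T = tern_component (2 * m) C"
  have carrier: "R \<subseteq> carrier_vec (2 * m)" "T \<subseteq> carrier_vec (2 * m)"
    by (auto simp: R_def T_def bin_component_def tern_component_def)
  \<comment> \<open>These memberships exclude the degenerate case of an empty set of sums, where a
    universal condition over \<open>R\<close> and \<open>T\<close> would hold vacuously.\<close>
  have zero: "0\<^sub>v (2 * m) \<in> R" "0\<^sub>v (2 * m) \<in> T"
    using zero_in_components[OF assms(2)]
    by (simp_all add: R_def T_def dual_code_def symp_form_F2_zero_left)
  have sum_eq_0: "a_vec u + b_vec v = 0\<^sub>v (2 * m) \<longleftrightarrow> u = 0\<^sub>v (2 * m) \<and> v = 0\<^sub>v (2 * m)"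
    if "u \<in> R" "v \<in> T" for u v
    using that carrier by (intro a_vec_plus_b_vec_eq_0_iff) auto
  have "symp_LCD_H23 m C \<longleftrightarrow> {a_vec u + b_vec v | u v. u \<in> R \<and> v \<in> T} = {0\<^sub>v (2 * m)}"
    by (simp add: symp_LCD_H23_def lcd_code_def radical_decomposition[OF assms(2)] R_def T_def)
  also have "\<dots> \<longleftrightarrow> (\<forall>u\<in>R. \<forall>v\<in>T. a_vec u + b_vec v = 0\<^sub>v (2 * m))"
  proof
    assume "{a_vec u + b_vec v | u v. u \<in> R \<and> v \<in> T} = {0\<^sub>v (2 * m)}"
    then show "\<forall>u\<in>R. \<forall>v\<in>T. a_vec u + b_vec v = 0\<^sub>v (2 * m)" by blast
  next
    assume "\<forall>u\<in>R. \<forall>v\<in>T. a_vec u + b_vec v = 0\<^sub>v (2 * m)"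
    moreover from this have "a_vec (0\<^sub>v (2 * m)) + b_vec (0\<^sub>v (2 * m)) = 0\<^sub>v (2 * m)"
      using zero by blast
    ultimately show "{a_vec u + b_vec v | u v. u \<in> R \<and> v \<in> T} = {0\<^sub>v (2 * m)}"
      using zero by (auto, metis)
  qed
  \<comment> \<open>From left to right, each u in \<open>R\<close> is paired with the zero of
    \<open>T\<close>, and each v in \<open>T\<close> with the zero of \<open>R\<close>.\<close>
  also have "\<dots> \<longleftrightarrow> R = {0\<^sub>v (2 * m)} \<and> T = {0\<^sub>v (2 * m)}"
    using zero sum_eq_0 by blast
  finally show ?thesis
    by (simp add: symp_LCD_F2_def lcd_code_def R_def T_def)
qed

end
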